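(* There exist infinitely many (pairwise non-isomorphic) ribbon graphs $G$ whose partial-dual Euler-genus polynomial $\sum_{A\subseteq E(G)} z^{\gamma(G^{*|_A})}$ is neither an odd polynomial, nor an even polynomial, nor an interpolating polynomial. In particular, it is false that for every ribbon graph $G$ this polynomial, if neither odd nor even, is interpolating.
   Context: A ribbon graph $G$ is a (possibly non-orientable) surface with boundary presented as a union of vertex discs and edge ribbons; $E(G)$ is its set of edges (ribbons), and $v(G)$, $e(G)$, $f(G)$, $c(G)$ are its numbers of vertices, edges, faces (boundary components) and connected components. The Euler genus is $\gamma(G)=2c(G)-v(G)+e(G)-f(G)$. For $A\subseteq E(G)$, the partial dual $G^{*|_A}$ is the ribbon graph obtained by gluing a disc along each boundary component of the spanning ribbon subgraph $(V(G),A)$ (these discs are the vertex discs of $G^{*|_A}$), and then removing the interiors of all the vertex discs of $G$; its edges are in bijection with those of $G$. The support of $f(z)=\sum_{i=0}^n a_i z^i$ is $\{i : a_i\neq 0\}$. A polynomial is interpolating if its support is an integer interval $[m,n]$ consisting of all integers from $m$ to $n$ inclusive; it is even (respectively odd) if all of its terms with non-zero coefficient have even (respectively odd) degree. *)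

theory Defs
  imports "HOL-Computational_Algebra.Polynomial"
begin

text \<open>
  Ribbon graphs are encoded combinatorially, up to homeomorphism. Each edge ribbon is a rectangle
  with four corners, all lying on the boundaries of the vertex discs. The corners are joined by
  three kinds of arcs, and every corner is an endpoint of exactly one arc of each kind:
  an end of a ribbon (where it is attached to a vertex disc), a free side of a ribbon, and a
  segment of the boundary of a vertex disc between consecutive ribbon ends. Each field
  \<open>end_arc\<close>, \<open>side_arc\<close>, \<open>free_arc\<close> sends a corner to the other endpoint of its arc.
  Vertex discs without ribbons carry no corners, so they are counted by \<open>isolated\<close>.
\<close>

record 'a pre_ribbon_graph =
  corners :: "'a set"
  end_arc :: "'a \<Rightarrow> 'a"
  side_arc :: "'a \<Rightarrow> 'a"
  free_arc :: "'a \<Rightarrow> 'a"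
  isolated :: nat

definition pairing_on :: "'a set \<Rightarrow> ('a \<Rightarrow> 'a) \<Rightarrow> bool" where
  "pairing_on S f \<longleftrightarrow> (\<forall>x\<in>S. f x \<in> S \<and> f x \<noteq> x \<and> f (f x) = x)"

text \<open>
  The last condition says that the ends and the sides of a ribbon bound a rectangle.
  No orientability is imposed.
\<close>

definition ribbon_graph :: "'a pre_ribbon_graph \<Rightarrow> bool" where
  "ribbon_graph G \<longleftrightarrow>
     finite (corners G) \<and>
     pairing_on (corners G) (end_arc G) \<and>
     pairing_on (corners G) (side_arc G) \<and>
     pairing_on (corners G) (free_arc G) \<and>
     (\<forall>x\<in>corners G. end_arc G x \<noteq> side_arc G x \<and>
        end_arc G (side_arc G x) = side_arc G (end_arc G x))"

definition classes :: "'a set \<Rightarrow> ('a \<Rightarrow> 'a) set \<Rightarrow> 'a set set" where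
  "classes S fs = S // {(x, f x) | x f. x \<in> S \<and> f \<in> fs}\<^sup>*"

definition edges :: "'a pre_ribbon_graph \<Rightarrow> 'a set set" where
  "edges G = classes (corners G) {end_arc G, side_arc G}"

text \<open>
  The boundary of the spanning ribbon subgraph with edge set \<open>A\<close> runs through all the free arcs;
  at a corner of a ribbon in \<open>A\<close> it continues along the side of that ribbon, and at a corner of a
  deleted ribbon it continues along the vertex disc, i.e. along the end where the ribbon was
  attached.
\<close>

definition boundary_arc :: "'a pre_ribbon_graph \<Rightarrow> 'a set set \<Rightarrow> 'a \<Rightarrow> 'a" where
  "boundary_arc G A x = (if x \<in> \<Union>A then side_arc G x else end_arc G x)"

definition boundary_components :: "'a pre_ribbon_graph \<Rightarrow> 'a set set \<Rightarrow> 'a set set" where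
  "boundary_components G A = classes (corners G) {free_arc G, boundary_arc G A}"

definition num_vertices :: "'a pre_ribbon_graph \<Rightarrow> nat" where
  "num_vertices G = card (classes (corners G) {free_arc G, end_arc G}) + isolated G"

definition num_edges :: "'a pre_ribbon_graph \<Rightarrow> nat" where
  "num_edges G = card (edges G)"

definition num_faces :: "'a pre_ribbon_graph \<Rightarrow> nat" where
  "num_faces G = card (boundary_components G (edges G)) + isolated G"

definition num_components :: "'a pre_ribbon_graph \<Rightarrow> nat" where
  "num_components G =
     card (classes (corners G) {free_arc G, end_arc G, side_arc G}) + isolated G"

definition euler_genus :: "'a pre_ribbon_graph \<Rightarrow> int" where
  "euler_genus G =
     2 * int (num_components G) - int (num_vertices G) + int (num_edges G) - int (num_faces G)"

text \<open>
  The vertex discs of the partial dual are glued along the boundary components of the spanning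
  ribbon subgraph with edge set \<open>A\<close>, so its ribbons meet them in the arcs \<open>boundary_arc G A\<close>.
  Once the interiors of the old vertex discs are removed, a ribbon in \<open>A\<close> is free along its former
  ends, and any other ribbon is free along the same sides as before. The free arcs are unchanged,
  and an isolated vertex is replaced by the disc glued along its boundary.
\<close>

definition partial_dual :: "'a pre_ribbon_graph \<Rightarrow> 'a set set \<Rightarrow> 'a pre_ribbon_graph" where
  "partial_dual G A = G\<lparr>
     end_arc := boundary_arc G A,
     side_arc := (\<lambda>x. if x \<in> \<Union>A then end_arc G x else side_arc G x)\<rparr>"

text \<open>The Euler genus is never negative, so \<open>nat\<close> does not truncate.\<close>

definition partial_dual_euler_genus_poly :: "'a pre_ribbon_graph \<Rightarrow> int poly" where
  "partial_dual_euler_genus_poly G =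
     (\<Sum>A\<in>Pow (edges G). monom 1 (nat (euler_genus (partial_dual G A))))"

text \<open>
  Homeomorphisms may reverse local orientations, so an isomorphism is just a bijection of the
  corners that respects the three kinds of arcs.
\<close>

definition isomorphic :: "'a pre_ribbon_graph \<Rightarrow> 'b pre_ribbon_graph \<Rightarrow> bool" where
  "isomorphic G H \<longleftrightarrow> isolated G = isolated H \<and>
     (\<exists>h. bij_betw h (corners G) (corners H) \<and>
        (\<forall>x\<in>corners G. h (end_arc G x) = end_arc H (h x) \<and>
                       h (side_arc G x) = side_arc H (h x) \<and>
                       h (free_arc G x) = free_arc H (h x)))"

definition poly_support :: "'a::zero poly \<Rightarrow> nat set" where
  "poly_support p = {i. coeff p i \<noteq> 0}"

definition interpolating :: "'a::zero poly \<Rightarrow> bool" where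
  "interpolating p \<longleftrightarrow> (\<exists>m n. poly_support p = {m..n})"

definition even_poly :: "'a::zero poly \<Rightarrow> bool" where
  "even_poly p \<longleftrightarrow> (\<forall>i\<in>poly_support p. even i)"

definition odd_poly :: "'a::zero poly \<Rightarrow> bool" where
  "odd_poly p \<longleftrightarrow> (\<forall>i\<in>poly_support p. odd i)"

lemma edges_eq:
  assumes "ribbon_graph G"
  shows "edges G =
    (\<lambda>x. {x, end_arc G x, side_arc G x, end_arc G (side_arc G x)}) ` corners G"
proof -
  let ?R = "{(x, f x) | x f. x \<in> corners G \<and> f \<in> {end_arc G, side_arc G}}"
  have "?R\<^sup>* `` {x} = {x, end_arc G x, side_arc G x, end_arc G (side_arc G x)}"
    if x: "x \<in> corners G" for x
  proof (intro equalityI subsetI)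
    fix y assume "y \<in> ?R\<^sup>* `` {x}"
    then have "(x, y) \<in> ?R\<^sup>*" by simp
    then show "y \<in> {x, end_arc G x, side_arc G x, end_arc G (side_arc G x)}"
      using assms x
      by (induction rule: rtrancl_induct) (auto simp: ribbon_graph_def pairing_on_def)
  next
    fix y assume y: "y \<in> {x, end_arc G x, side_arc G x, end_arc G (side_arc G x)}"
    have s: "side_arc G x \<in> corners G"
      using assms x by (auto simp: ribbon_graph_def pairing_on_def)
    have "(x, end_arc G x) \<in> ?R" "(x, side_arc G x) \<in> ?R"
      "(side_arc G x, end_arc G (side_arc G x)) \<in> ?R"
      using x s by blast+
    then show "y \<in> ?R\<^sup>* `` {x}"
      using y by (blast intro: rtrancl_trans)
  qed
  then show ?thesis
    unfolding edges_def classes_def quotient_def by auto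
qed

lemma arc_in_Union_edges_iff:
  assumes G: "ribbon_graph G" and A: "A \<subseteq> edges G" and x: "x \<in> corners G"
  shows "end_arc G x \<in> \<Union>A \<longleftrightarrow> x \<in> \<Union>A" "side_arc G x \<in> \<Union>A \<longleftrightarrow> x \<in> \<Union>A"
proof -
  have cl: "end_arc G y \<in> \<Union>A \<and> side_arc G y \<in> \<Union>A" if y: "y \<in> \<Union>A" for y
  proof -
    obtain a where a: "a \<in> A" "y \<in> a" using y by blast
    with A have "a \<in> edges G" by blast
    with edges_eq[OF G] obtain z where z: "z \<in> corners G"
      and "a = {z, end_arc G z, side_arc G z, end_arc G (side_arc G z)}" by auto
    with a G have "end_arc G y \<in> a \<and> side_arc G y \<in> a"
      by (auto simp: ribbon_graph_def pairing_on_def)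
    with a show ?thesis by blast
  qed
  have "end_arc G (end_arc G x) = x" "side_arc G (side_arc G x) = x"
    using G x by (auto simp: ribbon_graph_def pairing_on_def)
  then show "end_arc G x \<in> \<Union>A \<longleftrightarrow> x \<in> \<Union>A" "side_arc G x \<in> \<Union>A \<longleftrightarrow> x \<in> \<Union>A"
    using cl by metis+
qed

lemma ribbon_graph_partial_dual:
  assumes G: "ribbon_graph G" and A: "A \<subseteq> edges G"
  shows "ribbon_graph (partial_dual G A)"
  using G arc_in_Union_edges_iff[OF G A]
  unfolding ribbon_graph_def pairing_on_def partial_dual_def boundary_arc_def
  by simp metis

lemma edges_partial_dual:
  "edges (partial_dual G A) = edges G"
proof -
  have R: "{(x, f x) | x f. x \<in> corners G \<and> f \<in> {g, h}}
      = (\<Union>x\<in>corners G. {x} \<times> {g x, h x})" for g h :: "'a \<Rightarrow> 'a"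
    by blast
  have "{end_arc (partial_dual G A) x, side_arc (partial_dual G A) x}
      = {end_arc G x, side_arc G x}" for x
    by (auto simp: partial_dual_def boundary_arc_def)
  moreover have "corners (partial_dual G A) = corners G"
    by (simp add: partial_dual_def)
  ultimately show ?thesis
    unfolding edges_def classes_def by (simp only: R)
qed

lemma num_vertices_partial_dual:
  "num_vertices (partial_dual G A) = card (boundary_components G A) + isolated G"
  by (simp add: num_vertices_def boundary_components_def partial_dual_def)

end

theory Submission
  imports Defs
begin

text \<open>
  If \<open>b(A)\<close> is the number of boundary components of the spanning ribbon subgraph with edge set \<open>A\<close>,
  then the partial dual with respect to \<open>A\<close> has \<open>b(A)\<close> vertices and \<open>b(E - A)\<close> faces, while the
  numbers of edges and of components do not depend on \<open>A\<close>. Hence its Euler genus is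
  \<open>2 c + e - b(A) - b(E - A)\<close> (lemma \<open>euler_genus_partial_dual\<close>). All coefficients of the polynomial
  count sets of edges, so its support is exactly the set of these values.

  The counterexample is a bouquet of five loops: a twisted loop, and two pairs of untwisted loops
  such that the twisted loop and either pair form three mutually interlaced loops, while loops of
  different pairs are not interlaced. Let \<open>p\<close> and \<open>q\<close> be 1 if \<open>A\<close> contains exactly one loop of the
  first and of the second pair respectively, and 0 otherwise. Without the twisted loop the two
  pairs contribute independently and \<open>b(A) = 1 + p + q\<close>; with the twisted loop
  \<open>b(A) = 1 + p q\<close>. Replacing \<open>A\<close> by its complement changes neither \<open>p\<close> nor \<open>q\<close> and moves the
  twisted loop to the other side, so
    \<open>b(A) + b(E - A) = 2 + p + q + p q = 1 + (1 + p) (1 + q)\<close>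
  and the Euler genus is \<open>6 - (1 + p) (1 + q)\<close>. A product of two factors from \<open>{1, 2}\<close> can be
  1, 2 or 4 but not 3: the support is \<open>{2, 4, 5}\<close>, which has both parities and a gap at 3. The
  polynomial is \<open>8 z^2 + 16 z^4 + 8 z^5\<close>.

  An additional isolated vertex contributes \<open>2 - 1 - 1 = 0\<close> to every Euler genus, so adding \<open>m\<close>
  of them gives infinitely many examples, distinguished by \<open>m\<close>.

  The values \<open>b(A)\<close> are found by a union-find computation on the corners, whose correctness is lemma
  \<open>card_classes_eq_labels\<close>.
\<close>

section \<open>Euler genera of partial duals\<close>

lemma classes_cong:
  assumes "\<And>x. x \<in> S \<Longrightarrow> (\<lambda>f. f x) ` fs = (\<lambda>f. f x) ` gs"
  shows "classes S fs = classes S gs"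
proof -
  have "{(x, f x) | x f. x \<in> S \<and> f \<in> hs} = (\<Union>x\<in>S. {x} \<times> (\<lambda>f. f x) ` hs)"
    for hs :: "('a \<Rightarrow> 'a) set"
    by auto
  with assms show ?thesis
    unfolding classes_def by simp
qed

lemma edge_eq_of_corner:
  assumes G: "ribbon_graph G" and e: "e \<in> edges G" and x: "x \<in> e"
  shows "e = {x, end_arc G x, side_arc G x, end_arc G (side_arc G x)}"
proof -
  obtain z where z: "z \<in> corners G"
    and ez: "e = {z, end_arc G z, side_arc G z, end_arc G (side_arc G z)}"
    using e edges_eq[OF G] by auto
  have "end_arc G (end_arc G z) = z" "side_arc G (side_arc G z) = z"
    "side_arc G (end_arc G z) = end_arc G (side_arc G z)"
    "end_arc G (end_arc G (side_arc G z)) = side_arc G z"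
    "side_arc G (end_arc G (side_arc G z)) = end_arc G z"
    using G z unfolding ribbon_graph_def pairing_on_def by metis+
  with x show ?thesis
    unfolding ez by auto
qed

text \<open>Since the ribbons are disjoint, one corner decides whether its ribbon was chosen.\<close>

lemma corner_in_Union_iff:
  assumes G: "ribbon_graph G" and A: "A \<subseteq> edges G" and e: "e \<in> edges G" "x \<in> e"
  shows "x \<in> \<Union>A \<longleftrightarrow> e \<in> A"
proof -
  have "f = e" if "f \<in> A" "x \<in> f" for f
    using edge_eq_of_corner[OF G e] edge_eq_of_corner[OF G _ that(2)] A that(1) by blast
  with e show ?thesis by blast
qed

lemma corner_in_complement_iff:
  assumes G: "ribbon_graph G" and A: "A \<subseteq> edges G" and x: "x \<in> corners G"
  shows "x \<in> \<Union>(edges G - A) \<longleftrightarrow> x \<notin> \<Union>A"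
proof -
  obtain e where e: "e \<in> edges G" "x \<in> e"
    using x by (auto simp: edges_eq[OF G])
  show ?thesis
    unfolding corner_in_Union_iff[OF G A e] corner_in_Union_iff[OF G Diff_subset e]
    using e by simp
qed

text \<open>
  Exchanging ends and sides on the ribbons in \<open>A\<close> turns the boundary of the full dual into the
  boundary of the subgraph on the complement of \<open>A\<close>. The isolated vertices cancel: each one
  is a component, a vertex and a face.
\<close>

lemma euler_genus_partial_dual:
  assumes G: "ribbon_graph G" and A: "A \<subseteq> edges G"
  shows "euler_genus (partial_dual G A) =
    2 * int (card (classes (corners G) {free_arc G, end_arc G, side_arc G})) + int (num_edges G)
      - int (card (boundary_components G A)) - int (card (boundary_components G (edges G - A)))"
proof -
  let ?H = "partial_dual G A"
  have C: "corners ?H = corners G" "free_arc ?H = free_arc G" "isolated ?H = isolated G"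
    by (simp_all add: partial_dual_def)
  have comp: "classes (corners ?H) {free_arc ?H, end_arc ?H, side_arc ?H}
      = classes (corners G) {free_arc G, end_arc G, side_arc G}"
    unfolding C by (rule classes_cong) (auto simp: partial_dual_def boundary_arc_def)
  have faces: "boundary_components ?H (edges ?H) = boundary_components G (edges G - A)"
    unfolding boundary_components_def edges_partial_dual C
  proof (rule classes_cong)
    fix x assume x: "x \<in> corners G"
    then have "x \<in> \<Union>(edges G)"
      by (auto simp: edges_eq[OF G])
    then have "boundary_arc ?H (edges G) x = boundary_arc G (edges G - A) x"
      unfolding boundary_arc_def[of _ "edges G"] boundary_arc_def[of _ "edges G - A"]
        corner_in_complement_iff[OF G A x] by (simp add: partial_dual_def)
    then show "(\<lambda>f. f x) ` {free_arc G, boundary_arc ?H (edges G)}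
        = (\<lambda>f. f x) ` {free_arc G, boundary_arc G (edges G - A)}"
      by simp
  qed
  show ?thesis
    unfolding euler_genus_def num_components_def num_faces_def comp faces
      num_vertices_partial_dual
    by (simp add: num_edges_def edges_partial_dual C)
qed

text \<open>The coefficients are cardinalities, so no cancellation can occur.\<close>

lemma poly_support_partial_dual_euler_genus_poly:
  assumes "ribbon_graph G"
  shows "poly_support (partial_dual_euler_genus_poly G)
    = (\<lambda>A. nat (euler_genus (partial_dual G A))) ` Pow (edges G)"
proof -
  let ?g = "\<lambda>A. nat (euler_genus (partial_dual G A))"
  have "finite (edges G)"
    using assms by (auto simp: edges_eq ribbon_graph_def)
  then have fin: "finite (Pow (edges G))"
    by simp
  have "coeff (partial_dual_euler_genus_poly G) i
      = (\<Sum>A\<in>Pow (edges G). if ?g A = i then 1 else 0)" for i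
    by (simp add: partial_dual_euler_genus_poly_def coeff_sum)
  then have "coeff (partial_dual_euler_genus_poly G) i
      = int (card {A \<in> Pow (edges G). ?g A = i})" for i
    using fin by (simp add: sum.If_cases Int_def)
  then show ?thesis
    using fin by (auto simp: poly_support_def card_eq_0_iff)
qed

section \<open>Counting classes by merging labels\<close>

text \<open>
  The label of corner \<open>k\<close> is the entry \<open>k\<close> of the list. Processing a pair gives the whole
  class of its first component the label of the second, as in a union-find algorithm.
\<close>

definition merge_labels :: "nat \<times> nat \<Rightarrow> nat list \<Rightarrow> nat list" where
  "merge_labels p l = map (\<lambda>k. if k = l ! fst p then l ! snd p else k) l"

lemma length_fold_merge_labels: "length (fold merge_labels ps l) = length l"
  by (induction ps arbitrary: l) (auto simp: merge_labels_def)

text \<open>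
  The invariant of the computation: after any number of pairs, equality of labels is the
  equivalence relation generated by these pairs.
\<close>

lemma fold_merge_labels_eq_iff:
  assumes "set ps \<subseteq> {..<n} \<times> {..<n}" "u < n" "v < n"
  shows "fold merge_labels ps [0..<n] ! u = fold merge_labels ps [0..<n] ! v
    \<longleftrightarrow> (u, v) \<in> (set ps \<union> (set ps)\<inverse>)\<^sup>*"
  using assms
proof (induction ps arbitrary: u v rule: rev_induct)
  case Nil
  then show ?case by auto
next
  case (snoc p ps)
  obtain x y where p: "p = (x, y)" by (cases p)
  let ?l = "fold merge_labels ps [0..<n]"
  let ?R = "set ps \<union> (set ps)\<inverse>"
  let ?Q = "set (ps @ [p]) \<union> (set (ps @ [p]))\<inverse>"
  let ?m = "\<lambda>w. if ?l ! w = ?l ! x then ?l ! y else ?l ! w"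
  have xy: "x < n" "y < n" and ps: "set ps \<subseteq> {..<n} \<times> {..<n}"
    using snoc.prems p by auto
  have IH: "?l ! a = ?l ! b \<longleftrightarrow> (a, b) \<in> ?R\<^sup>*" if "a < n" "b < n" for a b
    using snoc.IH[OF ps that] .
  have m: "fold merge_labels (ps @ [p]) [0..<n] ! w = ?m w" if "w < n" for w
    using that by (simp add: merge_labels_def p length_fold_merge_labels)
  have sub: "?R\<^sup>* \<subseteq> ?Q\<^sup>*"
    by (rule rtrancl_mono) auto
  have Qxy: "(x, y) \<in> ?Q\<^sup>*" "(y, x) \<in> ?Q\<^sup>*"
    using p by auto
  have "?m u = ?m v \<longleftrightarrow> (u, v) \<in> ?Q\<^sup>*"
  proof
    assume eq: "?m u = ?m v"
    have merge_cases: "a = b \<or> (a = c \<and> d = b) \<or> (a = d \<and> c = b)"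
      if "(if a = c then d else a) = (if b = c then d else b)" for a b c d :: nat
      using that by (auto split: if_splits)
    have R: "(a, b) \<in> ?Q\<^sup>*" if "a < n" "b < n" "?l ! a = ?l ! b" for a b
      using iffD1[OF IH[OF that(1,2)] that(3)] sub by (rule subsetD[rotated])
    consider "?l ! u = ?l ! v" | "?l ! u = ?l ! x" "?l ! y = ?l ! v"
      | "?l ! u = ?l ! y" "?l ! x = ?l ! v"
      using merge_cases[OF eq] by blast
    then show "(u, v) \<in> ?Q\<^sup>*"
    proof cases
      case 1
      from R[OF snoc.prems(2,3) this] show ?thesis .
    next
      case 2
      from R[OF snoc.prems(2) xy(1) 2(1)] Qxy(1) have "(u, y) \<in> ?Q\<^sup>*"
        by (rule rtrancl_trans)
      from this R[OF xy(2) snoc.prems(3) 2(2)] show ?thesis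
        by (rule rtrancl_trans)
    next
      case 3
      from R[OF snoc.prems(2) xy(2) 3(1)] Qxy(2) have "(u, x) \<in> ?Q\<^sup>*"
        by (rule rtrancl_trans)
      from this R[OF xy(1) snoc.prems(3) 3(2)] show ?thesis
        by (rule rtrancl_trans)
    qed
  next
    assume "(u, v) \<in> ?Q\<^sup>*"
    then show "?m u = ?m v"
    proof (induction rule: rtrancl_induct)
      case (step a b)
      have "?m a = ?m b"
      proof (cases "(a, b) \<in> ?R")
        case True
        with ps have "a < n" "b < n" by auto
        then have "?l ! a = ?l ! b"
          using iffD2[OF IH r_into_rtrancl[OF True]] by simp
        then show ?thesis by simp
      next
        case False
        with step.hyps p have "(a, b) = (x, y) \<or> (a, b) = (y, x)" by auto
        then show ?thesis by auto
      qed
      with step.IH show ?case by simp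
    qed simp
  qed
  then show ?case
    using m snoc.prems by simp
qed

lemma card_image_eq_of_same_kernel:
  assumes "\<And>u v. u \<in> S \<Longrightarrow> v \<in> S \<Longrightarrow> f u = f v \<longleftrightarrow> g u = g v"
  shows "card (f ` S) = card (g ` S)"
proof -
  have inv: "inv_into S f (f u) \<in> S \<and> g (inv_into S f (f u)) = g u" if "u \<in> S" for u
    using assms that by (metis f_inv_into_f imageI inv_into_into)
  have "inj_on (\<lambda>y. g (inv_into S f y)) (f ` S)"
    using inv assms by (auto simp: inj_on_def)
  moreover have "(\<lambda>y. g (inv_into S f y)) ` f ` S = g ` S"
    using inv by (auto simp: image_image)
  ultimately show ?thesis
    by (metis card_image)
qed

lemma card_classes_eq_labels:
  assumes R: "{(x, f x) | x f. x \<in> {..<n} \<and> f \<in> fs} = set ps \<union> (set ps)\<inverse>"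
    and ps: "set ps \<subseteq> {..<n} \<times> {..<n}"
  shows "card (classes {..<n} fs) = card (set (fold merge_labels ps [0..<n]))"
proof -
  let ?R = "set ps \<union> (set ps)\<inverse>"
  let ?l = "fold merge_labels ps [0..<n]"
  have sym: "sym (?R\<^sup>*)"
    by (intro sym_rtrancl sym_Un_converse)
  have classes: "classes {..<n} fs = (\<lambda>u. ?R\<^sup>* `` {u}) ` {..<n}"
    unfolding classes_def R by (auto simp: quotient_def)
  have labels: "set ?l = (\<lambda>u. ?l ! u) ` {..<n}"
    by (auto simp: set_conv_nth length_fold_merge_labels)
  have kernel: "?R\<^sup>* `` {u} = ?R\<^sup>* `` {v} \<longleftrightarrow> ?l ! u = ?l ! v" if "u < n" "v < n" for u v
  proof -
    have "?R\<^sup>* `` {u} = ?R\<^sup>* `` {v} \<longleftrightarrow> (u, v) \<in> ?R\<^sup>*"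
    proof
      assume "?R\<^sup>* `` {u} = ?R\<^sup>* `` {v}"
      then have "v \<in> ?R\<^sup>* `` {u}" by blast
      then show "(u, v) \<in> ?R\<^sup>*" by blast
    next
      assume uv: "(u, v) \<in> ?R\<^sup>*"
      then have "(v, u) \<in> ?R\<^sup>*"
        by (rule symD[OF sym])
      then show "?R\<^sup>* `` {u} = ?R\<^sup>* `` {v}"
        using rtrancl_trans[OF uv] rtrancl_trans[of v u ?R] by blast
    qed
    then show ?thesis
      using fold_merge_labels_eq_iff[OF ps that] by simp
  qed
  show ?thesis
    unfolding classes labels using kernel by (intro card_image_eq_of_same_kernel) simp
qed

section \<open>Two triangles of interlaced loops sharing a twisted loop\<close>

text \<open>
  Going round the single vertex, the loops are met in the order 0 1 2 0 1 3 4 2 3 4; only loop 2 is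
  twisted. The loops 0, 1, 2 are mutually interlaced, and so are 2, 3, 4. The ribbon end at position
  \<open>k\<close> of this word has the corners \<open>2 k\<close> and \<open>2 k + 1\<close>, so that a side of an untwisted loop
  joins corners of different parity and a side of the twisted loop joins corners of equal parity.
  The arcs are lookups in lists indexed by the corners, and \<open>m\<close> counts additional isolated
  vertices.
\<close>

definition two_triangles :: "nat \<Rightarrow> nat pre_ribbon_graph" where
  "two_triangles m =
    \<lparr>corners = {..<20},
     end_arc = (!) [1,0, 3,2, 5,4, 7,6, 9,8, 11,10, 13,12, 15,14, 17,16, 19,18],
     side_arc = (!) [7,6, 9,8, 14,15, 1,0, 3,2, 17,16, 19,18, 4,5, 11,10, 13,12],
     free_arc = (!) [19, 2,1, 4,3, 6,5, 8,7, 10,9, 12,11, 14,13, 16,15, 18,17, 0],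
     isolated = m\<rparr>"

lemma lessThan_20: "{..<20} = {0::nat,1,2,3,4,5,6,7,8,9,10,11,12,13,14,15,16,17,18,19}"
  by (simp add: lessThan_nat_numeral lessThan_Suc) auto

lemma ribbon_graph_two_triangles: "ribbon_graph (two_triangles m)"
  by (simp add: ribbon_graph_def pairing_on_def two_triangles_def lessThan_20)

lemma edges_two_triangles:
  "edges (two_triangles m) = {{0,1,6,7}, {2,3,8,9}, {4,5,14,15}, {10,11,16,17}, {12,13,18,19}}"
  unfolding edges_eq[OF ribbon_graph_two_triangles]
  by (simp add: two_triangles_def lessThan_20 insert_commute)

text \<open>
  The boundary arcs of a spanning subgraph, each listed once; the five arguments say which of the
  loops 0, \<open>\<dots>\<close>, 4 belong to it.
\<close>

definition boundary_pairs :: "bool \<Rightarrow> bool \<Rightarrow> bool \<Rightarrow> bool \<Rightarrow> bool \<Rightarrow> (nat \<times> nat) list" where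
  "boundary_pairs a b c d e =
    (if a then [(0,7), (1,6)] else [(0,1), (6,7)]) @
    (if b then [(2,9), (3,8)] else [(2,3), (8,9)]) @
    (if c then [(4,14), (5,15)] else [(4,5), (14,15)]) @
    (if d then [(10,17), (11,16)] else [(10,11), (16,17)]) @
    (if e then [(12,19), (13,18)] else [(12,13), (18,19)])"

definition free_pairs :: "(nat \<times> nat) list" where
  "free_pairs = [(19,0), (1,2), (3,4), (5,6), (7,8), (9,10), (11,12), (13,14), (15,16), (17,18)]"

lemma free_labels:
  "fold merge_labels free_pairs [0..<20]
    = [0,2,2,4,4,6,6,8,8,10,10,12,12,14,14,16,16,18,18,0]"
  by (simp add: free_pairs_def merge_labels_def upt_rec)

text \<open>
  This is the formula for \<open>b(A)\<close> on which the gap rests, checked in all 32 cases. The labels that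
  the free arcs produce are the same in each case, so they are computed beforehand.
\<close>

lemma boundary_labels:
  "card (set (fold merge_labels (free_pairs @ boundary_pairs a b c d e) [0..<20]))
    = (if c then (if a \<noteq> b \<and> d \<noteq> e then 2 else 1) else 1 + of_bool (a \<noteq> b) + of_bool (d \<noteq> e))"
  unfolding fold_append comp_apply free_labels
  by (cases a; cases b; cases c; cases d; cases e)
    (simp_all add: boundary_pairs_def merge_labels_def card_insert_if)

lemma graph_of_pairing:
  assumes "\<forall>(x, y)\<in>set ps. f x = y \<and> f y = x"
    and "fst ` set ps \<union> snd ` set ps = S"
  shows "{(x, f x) | x. x \<in> S} = set ps \<union> (set ps)\<inverse>"
proof (intro set_eqI iffI)
  fix z assume "z \<in> {(x, f x) | x. x \<in> S}"
  then obtain x where z: "z = (x, f x)" and "x \<in> S" by blast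
  then obtain a b where "(a, b) \<in> set ps" "x = a \<or> x = b"
    using assms(2) by auto
  with assms(1) show "z \<in> set ps \<union> (set ps)\<inverse>"
    by (auto simp: z)
next
  fix z assume "z \<in> set ps \<union> (set ps)\<inverse>"
  then obtain a b where ab: "(a, b) \<in> set ps" and z: "z = (a, b) \<or> z = (b, a)"
    by (cases z) auto
  have "a \<in> S" "b \<in> S"
    using ab assms(2) by force+
  moreover have "f a = b" "f b = a"
    using ab assms(1) by auto
  ultimately show "z \<in> {(x, f x) | x. x \<in> S}"
    using z by auto
qed

lemma corners_of_free_pairs: "fst ` set free_pairs \<union> snd ` set free_pairs = {..<20}"
  by (simp add: free_pairs_def lessThan_20 set_eq_subset)

lemma corners_of_boundary_pairs:
  "fst ` set (boundary_pairs a b c d e) \<union> snd ` set (boundary_pairs a b c d e) = {..<20}"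
  by (cases a; cases b; cases c; cases d; cases e)
    (simp_all add: boundary_pairs_def lessThan_20 set_eq_subset)

lemma free_arc_two_triangles:
  "{(x, free_arc (two_triangles m) x) | x. x \<in> {..<20}} = set free_pairs \<union> (set free_pairs)\<inverse>"
  by (rule graph_of_pairing[OF _ corners_of_free_pairs])
    (simp add: free_pairs_def two_triangles_def)

lemma card_boundary_components_two_triangles:
  assumes A: "A \<subseteq> edges (two_triangles m)"
  shows "card (boundary_components (two_triangles m) A)
    = card (set (fold merge_labels (free_pairs @
        boundary_pairs ({0,1,6,7} \<in> A) ({2,3,8,9} \<in> A) ({4,5,14,15} \<in> A)
          ({10,11,16,17} \<in> A) ({12,13,18,19} \<in> A)) [0..<20]))"
proof -
  let ?G = "two_triangles m"
  let ?ps = "boundary_pairs ({0,1,6,7} \<in> A) ({2,3,8,9} \<in> A) ({4,5,14,15} \<in> A)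
          ({10,11,16,17} \<in> A) ({12,13,18,19} \<in> A)"
  have C: "corners ?G = {..<20}"
    by (simp add: two_triangles_def)
  have b: "\<forall>x\<in>e. boundary_arc ?G A x = (if e \<in> A then side_arc ?G x else end_arc ?G x)"
    if "e \<in> edges ?G" for e
    using corner_in_Union_iff[OF ribbon_graph_two_triangles A that]
    by (simp add: boundary_arc_def)
  have "\<forall>(x, y)\<in>set ?ps. boundary_arc ?G A x = y \<and> boundary_arc ?G A y = x"
    using b[of "{0,1,6,7}"] b[of "{2,3,8,9}"] b[of "{4,5,14,15}"] b[of "{10,11,16,17}"]
      b[of "{12,13,18,19}"]
    unfolding edges_two_triangles boundary_pairs_def set_append ball_Un
    by (simp add: two_triangles_def)
  then have "{(x, boundary_arc ?G A x) | x. x \<in> {..<20}} = set ?ps \<union> (set ?ps)\<inverse>"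
    by (rule graph_of_pairing[OF _ corners_of_boundary_pairs])
  moreover have "{(x, f x) | x f. x \<in> {..<20} \<and> f \<in> {free_arc ?G, boundary_arc ?G A}}
      = {(x, free_arc ?G x) | x. x \<in> {..<20}} \<union> {(x, boundary_arc ?G A x) | x. x \<in> {..<20}}"
    by auto
  ultimately have R: "{(x, f x) | x f. x \<in> {..<20} \<and> f \<in> {free_arc ?G, boundary_arc ?G A}}
      = set (free_pairs @ ?ps) \<union> (set (free_pairs @ ?ps))\<inverse>"
    unfolding free_arc_two_triangles by auto
  have "set (free_pairs @ ?ps) \<subseteq> {..<20} \<times> {..<20}"
    by (simp add: free_pairs_def boundary_pairs_def)
  from card_classes_eq_labels[OF R this] show ?thesis
    unfolding boundary_components_def C .
qed

lemma components_two_triangles: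
  "card (classes (corners (two_triangles m))
      {free_arc (two_triangles m), end_arc (two_triangles m), side_arc (two_triangles m)}) = 1"
proof -
  let ?G = "two_triangles m"
  \<comment> \<open>With no loop chosen the boundary follows all the ends, with all chosen it follows all the
    sides.\<close>
  let ?e = "boundary_pairs False False False False False"
  let ?s = "boundary_pairs True True True True True"
  let ?ps = "free_pairs @ ?e @ ?s"
  have C: "corners ?G = {..<20}"
    by (simp add: two_triangles_def)
  have e: "{(x, end_arc ?G x) | x. x \<in> {..<20}} = set ?e \<union> (set ?e)\<inverse>"
    by (rule graph_of_pairing[OF _ corners_of_boundary_pairs])
      (simp add: boundary_pairs_def two_triangles_def)
  have s: "{(x, side_arc ?G x) | x. x \<in> {..<20}} = set ?s \<union> (set ?s)\<inverse>"
    by (rule graph_of_pairing[OF _ corners_of_boundary_pairs])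
      (simp add: boundary_pairs_def two_triangles_def)
  have "{(x, f x) | x f. x \<in> {..<20} \<and> f \<in> {free_arc ?G, end_arc ?G, side_arc ?G}}
      = {(x, free_arc ?G x) | x. x \<in> {..<20}} \<union> {(x, end_arc ?G x) | x. x \<in> {..<20}}
        \<union> {(x, side_arc ?G x) | x. x \<in> {..<20}}"
    by auto
  then have R: "{(x, f x) | x f. x \<in> {..<20} \<and> f \<in> {free_arc ?G, end_arc ?G, side_arc ?G}}
      = set ?ps \<union> (set ?ps)\<inverse>"
    unfolding free_arc_two_triangles e s by auto
  have ps: "set ?ps \<subseteq> {..<20} \<times> {..<20}"
    by (simp add: free_pairs_def boundary_pairs_def)
  have labels: "card (set (fold merge_labels ?ps [0..<20])) = 1"
    unfolding fold_append comp_apply free_labels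
    by (simp add: boundary_pairs_def merge_labels_def)
  show ?thesis
    unfolding C by (rule trans[OF card_classes_eq_labels[OF R ps] labels])
qed

lemma distinct_ribbons:
  "distinct [{0,1,6,7}, {2,3,8,9}, {4,5,14,15}, {10,11,16,17}, {12,13,18,19::nat}]"
  by (simp add: set_eq_subset)

text \<open>
  Here \<open>p\<close> and \<open>q\<close> are invariant under complementing \<open>A\<close>, whereas membership of the twisted loop is
  not; so exactly one of \<open>b(A)\<close>, \<open>b(E - A)\<close> is \<open>1 + p + q\<close> and the other is \<open>1 + p q\<close>.
\<close>

lemma euler_genus_two_triangles:
  assumes A: "A \<subseteq> edges (two_triangles m)"
  defines "p \<equiv> of_bool (({0,1,6,7} \<in> A) \<noteq> ({2,3,8,9} \<in> A))"
    and "q \<equiv> of_bool (({10,11,16,17} \<in> A) \<noteq> ({12,13,18,19} \<in> A))"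
  shows "euler_genus (partial_dual (two_triangles m) A) = 6 - (1 + p) * (1 + q)"
proof -
  let ?G = "two_triangles m"
  let ?B = "edges ?G - A"
  have E: "{0,1,6,7} \<in> edges ?G" "{2,3,8,9} \<in> edges ?G" "{4,5,14,15} \<in> edges ?G"
    "{10,11,16,17} \<in> edges ?G" "{12,13,18,19} \<in> edges ?G"
    unfolding edges_two_triangles by (simp_all only: insertI1 insertI2)
  have "num_edges ?G = 5"
    unfolding num_edges_def edges_two_triangles
    using distinct_card[OF distinct_ribbons] by simp
  moreover have "int (card (boundary_components ?G A))
      = (if {4,5,14,15} \<in> A then 1 + p * q else 1 + p + q)"
    unfolding card_boundary_components_two_triangles[OF A] boundary_labels
    by (simp add: p_def q_def)
  moreover have "int (card (boundary_components ?G ?B))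
      = (if {4,5,14,15} \<in> A then 1 + p + q else 1 + p * q)"
    unfolding card_boundary_components_two_triangles[OF Diff_subset] boundary_labels
    using E by (simp add: p_def q_def)
  ultimately show ?thesis
    unfolding euler_genus_partial_dual[OF ribbon_graph_two_triangles A] components_two_triangles
    by (simp add: algebra_simps)
qed

lemma poly_support_two_triangles:
  "poly_support (partial_dual_euler_genus_poly (two_triangles m)) = {2, 4, 5}"
proof -
  let ?G = "two_triangles m"
  let ?g = "\<lambda>A. nat (euler_genus (partial_dual ?G A))"
  \<comment> \<open>The genera 5, 4 and 2 arise for \<open>p = q = 0\<close>, for \<open>{p, q} = {0, 1}\<close> and for \<open>p = q = 1\<close>.\<close>
  have "?g A \<in> {2, 4, 5}" if "A \<in> Pow (edges ?G)" for A
    using that by (simp add: euler_genus_two_triangles of_bool_def)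
  moreover have "?g {} = 5"
    by (simp add: euler_genus_two_triangles)
  moreover have "?g {{0,1,6,7}} = 4"
    by (simp add: euler_genus_two_triangles edges_two_triangles set_eq_subset)
  moreover have "?g {{0,1,6,7}, {10,11,16,17}} = 2"
    by (simp add: euler_genus_two_triangles edges_two_triangles set_eq_subset)
  moreover have "{{}, {{0,1,6,7}}, {{0,1,6,7}, {10,11,16,17}}} \<subseteq> Pow (edges ?G)"
    unfolding edges_two_triangles by simp
  ultimately show ?thesis
    unfolding poly_support_partial_dual_euler_genus_poly[OF ribbon_graph_two_triangles]
    by (intro equalityI image_subsetI) (auto simp del: Pow_iff intro: rev_image_eqI)
qed

theorem mainTheorem1:
  "(\<exists>\<G> :: nat pre_ribbon_graph set.
      infinite \<G> \<and>
      (\<forall>G\<in>\<G>. ribbon_graph G \<and>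
         \<not> odd_poly (partial_dual_euler_genus_poly G) \<and>
         \<not> even_poly (partial_dual_euler_genus_poly G) \<and>
         \<not> interpolating (partial_dual_euler_genus_poly G)) \<and>
      (\<forall>G\<in>\<G>. \<forall>H\<in>\<G>. G \<noteq> H \<longrightarrow> \<not> isomorphic G H)) \<and>
   \<not> (\<forall>G :: nat pre_ribbon_graph. ribbon_graph G \<longrightarrow>
        \<not> odd_poly (partial_dual_euler_genus_poly G) \<longrightarrow>
        \<not> even_poly (partial_dual_euler_genus_poly G) \<longrightarrow>
        interpolating (partial_dual_euler_genus_poly G))"
proof -
  have no_interval: "{2, 4, 5} \<noteq> {a..b}" for a b :: nat
  proof
    assume eq: "{2, 4, 5} = {a..b}"
    then have "2 \<in> {a..b}" "4 \<in> {a..b}"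
      by blast+
    then have "3 \<in> {a..b}"
      by simp
    then have "3 \<in> {2, 4, 5::nat}"
      unfolding eq .
    then show False
      by simp
  qed
  have counterexample: "ribbon_graph (two_triangles m) \<and>
      \<not> odd_poly (partial_dual_euler_genus_poly (two_triangles m)) \<and>
      \<not> even_poly (partial_dual_euler_genus_poly (two_triangles m)) \<and>
      \<not> interpolating (partial_dual_euler_genus_poly (two_triangles m))" for m
    using no_interval
    by (simp add: ribbon_graph_two_triangles odd_poly_def even_poly_def interpolating_def
        poly_support_two_triangles)
  have iso: "isolated (two_triangles m) = m" for m
    by (simp add: two_triangles_def)
  have "inj two_triangles"
    by (rule injI) (metis iso)
  then have "infinite (range two_triangles)"
    by (rule range_inj_infinite)
  moreover have "\<not> isomorphic G H"
    if "G \<in> range two_triangles" "H \<in> range two_triangles" "G \<noteq> H" for G H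
    using that by (auto simp: isomorphic_def iso)
  ultimately have "\<exists>\<G> :: nat pre_ribbon_graph set.
      infinite \<G> \<and>
      (\<forall>G\<in>\<G>. ribbon_graph G \<and>
         \<not> odd_poly (partial_dual_euler_genus_poly G) \<and>
         \<not> even_poly (partial_dual_euler_genus_poly G) \<and>
         \<not> interpolating (partial_dual_euler_genus_poly G)) \<and>
      (\<forall>G\<in>\<G>. \<forall>H\<in>\<G>. G \<noteq> H \<longrightarrow> \<not> isomorphic G H)"
    using counterexample by (intro exI[of _ "range two_triangles"]) blast
  with counterexample show ?thesis
    by blast
qed

end
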